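(* For every integer $n\geq 2$, the Baumslag-Solitar group $BS(n,n)$ admits a strongly aperiodic subshift of finite type.
   Context: $BS(n,n)=\langle a,b \mid b a^n b^{-1} = a^n\rangle$. Let $G$ be a finitely generated group with identity $e$ and $\mathcal{A}$ a finite alphabet. $G$ acts on $\mathcal{A}^G$ by $(g\cdot x)_h = x_{g^{-1}h}$. A pattern is an element $p\in\mathcal{A}^{P}$ with $P\subset G$ finite; it appears in $x\in\mathcal{A}^G$ if there is $g\in G$ with $(g\cdot x)_h=p_h$ for all $h\in P$. A subshift of finite type (SFT) on $G$ is the set of all $x\in\mathcal{A}^G$ in which no pattern of some fixed finite set of patterns appears. A configuration $x$ is weakly periodic if its stabilizer $\{g\in G\mid g\cdot x=x\}$ is not $\{e\}$. An SFT is strongly aperiodic if it is non-empty and contains no weakly periodic configuration. *)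

theory Defs
  imports "HOL-Algebra.Group_Action" "HOL-Algebra.Generated_Groups"
begin

section \<open>Groups given by generators and relations\<close>

text \<open>A letter \<open>(x, True)\<close> stands for the generator \<open>x\<close> and \<open>(x, False)\<close> for its formal inverse.
  A relation is a pair of words to be identified. Elements of the presented group are the classes
  of words modulo the least congruence that contains free cancellation and the relations.\<close>

type_synonym 'x word = "('x \<times> bool) list"

inductive_set pres_rel :: "('x word \<times> 'x word) set \<Rightarrow> ('x word \<times> 'x word) set"
  for R :: "('x word \<times> 'x word) set" where
  refl: "(u, u) \<in> pres_rel R"
| sym: "(u, v) \<in> pres_rel R \<Longrightarrow> (v, u) \<in> pres_rel R"
| trans: "(u, v) \<in> pres_rel R \<Longrightarrow> (v, w) \<in> pres_rel R \<Longrightarrow> (u, w) \<in> pres_rel R"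
| cancel: "(u @ [(x, s), (x, \<not> s)] @ v, u @ v) \<in> pres_rel R"
| relation: "(l, r) \<in> R \<Longrightarrow> (u @ l @ v, u @ r @ v) \<in> pres_rel R"

definition presented_group :: "('x word \<times> 'x word) set \<Rightarrow> 'x word set monoid" where
  "presented_group R =
     \<lparr> carrier = UNIV // pres_rel R,
       monoid.mult = (\<lambda>A B. \<Union>u\<in>A. \<Union>v\<in>B. pres_rel R `` {u @ v}),
       one = pres_rel R `` {[]} \<rparr>"

lemma equiv_pres_rel: "equiv UNIV (pres_rel R)"
  by (auto intro!: equivI refl_onI symI transI intro: pres_rel.intros)

lemma pres_rel_context:
  "(u, v) \<in> pres_rel R \<Longrightarrow> (p @ u @ q, p @ v @ q) \<in> pres_rel R"
proof (induction rule: pres_rel.induct)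
  case (cancel u x s v)
  show ?case using pres_rel.cancel[of "p @ u" x s "v @ q" R] by simp
next
  case (relation l r u v)
  then show ?case using pres_rel.relation[of l r R "p @ u" "v @ q"] by simp
qed (auto intro: pres_rel.intros)

lemma pres_rel_append_congruent:
  "congruent2 (pres_rel R) (pres_rel R) (\<lambda>u v. pres_rel R `` {u @ v})"
proof (rule congruent2I'[OF equiv_class_eq[OF equiv_pres_rel]])
  fix u u' v v' assume "(u, u') \<in> pres_rel R" "(v, v') \<in> pres_rel R"
  then have "(u @ v, u' @ v) \<in> pres_rel R" "(u' @ v, u' @ v') \<in> pres_rel R"
    using pres_rel_context[of u u' R "[]" v] pres_rel_context[of v v' R u' "[]"] by auto
  then show "(u @ v, u' @ v') \<in> pres_rel R"
    by (rule pres_rel.trans)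
qed

lemma presented_group_mult:
  "(pres_rel R `` {u}) \<otimes>\<^bsub>presented_group R\<^esub> (pres_rel R `` {v}) = pres_rel R `` {u @ v}"
  using UN_equiv_class2[OF equiv_pres_rel equiv_pres_rel pres_rel_append_congruent]
  by (simp add: presented_group_def)

lemma presented_group_one: "\<one>\<^bsub>presented_group R\<^esub> = pres_rel R `` {[]}"
  by (simp add: presented_group_def)

lemma presented_group_carrier: "carrier (presented_group R) = range (\<lambda>u. pres_rel R `` {u})"
  by (auto simp: presented_group_def quotient_def)

definition inverse_word :: "'x word \<Rightarrow> 'x word" where
  "inverse_word u = rev (map (\<lambda>(x, s). (x, \<not> s)) u)"

lemma inverse_word_left: "(inverse_word u @ u, []) \<in> pres_rel R"
proof (induction u)
  case Nil
  show ?case by (simp add: inverse_word_def pres_rel.refl)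
next
  case (Cons y u)
  obtain x s where y: "y = (x, s)" by fastforce
  have "(inverse_word (y # u) @ y # u, inverse_word u @ u) \<in> pres_rel R"
    using pres_rel.cancel[of "inverse_word u" x "\<not> s" u R] by (simp add: inverse_word_def y)
  then show ?case using Cons.IH by (rule pres_rel.trans)
qed

lemma presented_group_is_group: "group (presented_group R)"
proof (rule groupI)
  fix A assume "A \<in> carrier (presented_group R)"
  then obtain u where u: "A = pres_rel R `` {u}" by (auto simp: presented_group_carrier)
  have "(pres_rel R `` {inverse_word u}) \<otimes>\<^bsub>presented_group R\<^esub> A = \<one>\<^bsub>presented_group R\<^esub>"
    by (simp add: u presented_group_mult presented_group_one
        equiv_class_eq[OF equiv_pres_rel inverse_word_left])
  then show "\<exists>B\<in>carrier (presented_group R). B \<otimes>\<^bsub>presented_group R\<^esub> A = \<one>\<^bsub>presented_group R\<^esub>"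
    by (auto simp: presented_group_carrier)
qed (auto simp: presented_group_carrier presented_group_mult presented_group_one)

lemma presented_group_generated:
  "generate (presented_group R) (range (\<lambda>x. pres_rel R `` {[(x, True)]}))
     = carrier (presented_group R)" (is "generate ?G ?S = _")
proof
  interpret group ?G by (rule presented_group_is_group)
  show "generate ?G ?S \<subseteq> carrier ?G"
    by (rule generate_incl) (auto simp: presented_group_carrier)
  have letter: "pres_rel R `` {[(x, s)]} \<in> generate ?G ?S" for x s
  proof (cases s)
    case True
    then show ?thesis by (auto intro: generate.incl)
  next
    case False
    have "(pres_rel R `` {[(x, False)]}) \<otimes>\<^bsub>?G\<^esub> (pres_rel R `` {[(x, True)]}) = \<one>\<^bsub>?G\<^esub>"
      using equiv_class_eq[OF equiv_pres_rel pres_rel.cancel[of "[]" x False "[]" R]]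
      by (simp add: presented_group_mult presented_group_one)
    then have "inv\<^bsub>?G\<^esub> (pres_rel R `` {[(x, True)]}) = pres_rel R `` {[(x, False)]}"
      by (rule inv_equality) (auto simp: presented_group_carrier)
    then show ?thesis using False generate.inv[of "pres_rel R `` {[(x, True)]}" ?S ?G] by auto
  qed
  have "pres_rel R `` {u} \<in> generate ?G ?S" for u
  proof (induction u)
    case Nil
    show ?case using generate.one[of ?G ?S] by (simp add: presented_group_one)
  next
    case (Cons y u)
    have "pres_rel R `` {y # u} = (pres_rel R `` {[y]}) \<otimes>\<^bsub>?G\<^esub> (pres_rel R `` {u})"
      by (simp add: presented_group_mult)
    then show ?case using generate.eng[OF letter[of "fst y" "snd y"] Cons.IH] by simp
  qed
  then show "carrier ?G \<subseteq> generate ?G ?S" by (auto simp: presented_group_carrier)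
qed


section \<open>Baumslag-Solitar groups\<close>

datatype bs_gen = Gen_a | Gen_b

text \<open>\<open>BS m n\<close> is presented by generators \<open>a, b\<close> and the relation \<open>b a\<^sup>m b\<^sup>-\<^sup>1 = a\<^sup>n\<close>,
  here for nonnegative exponents only.\<close>

definition BS :: "nat \<Rightarrow> nat \<Rightarrow> bs_gen word set monoid" where
  "BS m n = presented_group
     {([(Gen_b, True)] @ replicate m (Gen_a, True) @ [(Gen_b, False)], replicate n (Gen_a, True))}"


section \<open>Subshifts of finite type\<close>

text \<open>Configurations are functions on the carrier of the group, extended by \<open>undefined\<close> outside it.\<close>

definition configurations :: "('g, 'm) monoid_scheme \<Rightarrow> 'a set \<Rightarrow> ('g \<Rightarrow> 'a) set" where
  "configurations G A = carrier G \<rightarrow>\<^sub>E A"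

definition shift :: "('g, 'm) monoid_scheme \<Rightarrow> 'a set \<Rightarrow> 'g \<Rightarrow> ('g \<Rightarrow> 'a) \<Rightarrow> ('g \<Rightarrow> 'a)" where
  "shift G A g = (\<lambda>x\<in>configurations G A. \<lambda>h\<in>carrier G. x (inv\<^bsub>G\<^esub> g \<otimes>\<^bsub>G\<^esub> h))"

lemma group_action_shift:
  assumes "group G"
  shows "group_action G (configurations G A) (shift G A)"
proof -
  interpret group G by fact
  let ?C = "configurations G A"
  have closed: "shift G A g x \<in> ?C" if "g \<in> carrier G" "x \<in> ?C" for g x
    using that by (auto simp: shift_def configurations_def PiE_iff)
  have comp: "shift G A g (shift G A h x) = shift G A (g \<otimes>\<^bsub>G\<^esub> h) x"
    if "g \<in> carrier G" "h \<in> carrier G" "x \<in> ?C" for g h x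
    using that closed[of h x]
    by (auto simp: shift_def inv_mult_group m_assoc intro!: restrict_ext)
  have one: "shift G A \<one>\<^bsub>G\<^esub> x = x" if "x \<in> ?C" for x
    using that by (auto simp: shift_def configurations_def PiE_iff extensional_def restrict_def)
  have bij: "shift G A g \<in> Bij ?C" if g: "g \<in> carrier G" for g
  proof -
    have "bij_betw (shift G A g) ?C ?C"
      by (rule bij_betwI[where g = "shift G A (inv\<^bsub>G\<^esub> g)"])
        (use g in \<open>auto simp: closed comp one\<close>)
    then show ?thesis by (auto simp: Bij_def shift_def)
  qed
  have "shift G A (g \<otimes>\<^bsub>G\<^esub> h) = compose ?C (shift G A g) (shift G A h)"
    if "g \<in> carrier G" "h \<in> carrier G" for g h
  proof
    fix x show "shift G A (g \<otimes>\<^bsub>G\<^esub> h) x = compose ?C (shift G A g) (shift G A h) x"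
    proof (cases "x \<in> ?C")
      case True
      then show ?thesis using that by (simp add: compose_def comp)
    next
      case False
      then show ?thesis by (simp add: compose_def shift_def)
    qed
  qed
  then have "shift G A \<in> hom G (BijGroup ?C)"
    by (auto simp: hom_def BijGroup_def bij)
  then show ?thesis
    by (simp add: group_action_def group_hom_def group_hom_axioms_def group_BijGroup assms)
qed

definition weakly_periodic :: "('g, 'm) monoid_scheme \<Rightarrow> 'a set \<Rightarrow> ('g \<Rightarrow> 'a) \<Rightarrow> bool" where
  "weakly_periodic G A x \<longleftrightarrow> stabilizer G (shift G A) x \<noteq> {\<one>\<^bsub>G\<^esub>}"

text \<open>A pattern is represented as the pair \<open>(P, p)\<close> of its support and its values.\<close>

definition patterns :: "('g, 'm) monoid_scheme \<Rightarrow> 'a set \<Rightarrow> ('g set \<times> ('g \<Rightarrow> 'a)) set" where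
  "patterns G A = {(P, p). finite P \<and> P \<subseteq> carrier G \<and> p \<in> P \<rightarrow>\<^sub>E A}"

definition appears ::
    "('g, 'm) monoid_scheme \<Rightarrow> 'a set \<Rightarrow> 'g set \<times> ('g \<Rightarrow> 'a) \<Rightarrow> ('g \<Rightarrow> 'a) \<Rightarrow> bool" where
  "appears G A = (\<lambda>(P, p) x. \<exists>g\<in>carrier G. \<forall>h\<in>P. shift G A g x h = p h)"

definition SFT :: "('g, 'm) monoid_scheme \<Rightarrow> 'a set \<Rightarrow> ('g \<Rightarrow> 'a) set \<Rightarrow> bool" where
  "SFT G A X \<longleftrightarrow>
     (\<exists>F. finite F \<and> F \<subseteq> patterns G A \<and>
          X = {x \<in> configurations G A. \<forall>p\<in>F. \<not> appears G A p x})"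

definition strongly_aperiodic :: "('g, 'm) monoid_scheme \<Rightarrow> 'a set \<Rightarrow> ('g \<Rightarrow> 'a) set \<Rightarrow> bool" where
  "strongly_aperiodic G A X \<longleftrightarrow> X \<noteq> {} \<and> (\<forall>x\<in>X. \<not> weakly_periodic G A x)"

end

theory Submission
  imports Defs "HOL-Library.Countable" Complex_Main
begin

text \<open>The group acts on its Bass-Serre tree, whose vertices are the cosets \<open>g\<langle>a\<rangle>\<close>. A local rule lets
  each vertex choose a parent such that every edge joins a vertex to its parent, so all paths of
  successive parents merge. As in Kari's aperiodic tilings of the plane, each coset carries a row
  of digits representing a positive real number, and a transducer rule with carries
  forces the number of the parent to be 2 or 2/3 times the number of the vertex. By merging, a period
  either makes a row a translate of one of its proper ancestors, which contradicts
  \<open>2\<^sup>l \<noteq> 3\<^sup>s\<close> for the averages, or makes all ancestors of one row periodic with the same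
  period \<open>N\<close>, so that \<open>2\<^sup>j\<close> divides the digit sum over a period of the \<open>j\<close>-th ancestor,
  a number between \<open>2N\<close> and \<open>6N\<close>. For existence one orients the tree towards an end,
  follows the bijection of the interval \<open>(2, 6]\<close> that multiplies by 2 or 2/3, and takes Beatty
  sequences as rows.\<close>

section \<open>Multiplication of rows by 2 and 2/3\<close>

text \<open>Summing \<open>step\<close> over consecutive positions cancels the inner carries: sums
  over row \<open>Suc j\<close> are 2 / \<open>r j\<close> times those over row \<open>j\<close>, up
  to a bounded error.\<close>

locale multiplied_rows =
  fixes r :: "nat \<Rightarrow> int" and d c :: "nat \<Rightarrow> int \<Rightarrow> int"
  assumes r: "r j \<in> {1, 3}"
    and d: "d j k \<in> {2..6}"
    and c: "c j k \<in> {-2..1}"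
    and step: "r j * d (Suc j) k + c j k = 2 * d j k + c j (k + 1)"
begin

definition R :: "nat \<Rightarrow> int" where "R j = (\<Prod>i<j. r i)"

definition S :: "nat \<Rightarrow> nat \<Rightarrow> int" where "S N j = (\<Sum>k<N. d j (int k))"

lemma odd_R: "odd (R j)"
proof (induction j)
  case (Suc j)
  then show ?case using r[of j] by (auto simp: R_def)
qed (simp add: R_def)

lemma R_pos: "R j > 0"
  unfolding R_def
proof (rule prod_pos)
  show "0 < r i" for i using r[of i] by auto
qed

lemma S_step: "r j * S N (Suc j) + c j 0 = 2 * S N j + c j (int N)"
proof (induction N)
  case (Suc N)
  then show ?case using step[of j "int N"] by (simp add: S_def algebra_simps)
qed (simp add: S_def)

lemma S_lower: "2 * int N \<le> S N j"
  using sum_bounded_below[of "{..<N}" 2 "\<lambda>k. d j (int k)"] d by (simp add: S_def mult.commute)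

lemma S_upper: "S N j \<le> 6 * int N"
  using sum_bounded_above[of "{..<N}" "\<lambda>k. d j (int k)" 6] d by (simp add: S_def mult.commute)

text \<open>Equal carries make \<open>S_step\<close> exact. As \<open>R j\<close> is odd,
  \<open>2 ^ j\<close> then divides the positive number \<open>S N j\<close>, which exceeds the
  bound \<open>6 * N\<close> for large \<open>j\<close>.\<close>

lemma no_horizontal_period:
  assumes "N > 0" "\<And>j. c j (int N) = c j 0"
  shows False
proof -
  have eq: "R j * S N j = 2 ^ j * S N 0" for j
  proof (induction j)
    case (Suc j)
    have "R (Suc j) * S N (Suc j) = R j * (r j * S N (Suc j))"
      by (simp add: R_def)
    also have "\<dots> = 2 * (R j * S N j)"
      using S_step[of j N] assms(2)[of j] by simp
    finally show ?case using Suc by simp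
  qed (simp add: R_def)
  obtain j where j: "6 * N < 2 ^ j"
    using less_exp by blast
  have "coprime (2 ^ j) (R j)"
    using odd_R by simp
  moreover have "2 ^ j dvd R j * S N j"
    by (simp add: eq)
  ultimately have "2 ^ j dvd S N j"
    by (simp add: coprime_dvd_mult_right_iff)
  moreover have "0 < S N j"
    using S_lower[of N j] assms(1) by linarith
  ultimately have "2 ^ j \<le> S N j"
    by (rule zdvd_imp_le)
  moreover have "6 * int N < 2 ^ j"
    using j by (metis of_nat_less_iff of_nat_mult of_nat_numeral of_nat_power)
  ultimately show False
    using S_upper[of N j] by linarith
qed

text \<open>Two carries differ by at most 3, so each row doubles the error and adds at most
  \<open>3 * R j\<close>, uniformly in \<open>N\<close>.\<close>

lemma S_close: "\<exists>K. \<forall>N. \<bar>R j * S N j - 2 ^ j * S N 0\<bar> \<le> K"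
proof (induction j)
  case (Suc j)
  then obtain K where K: "\<bar>R j * S N j - 2 ^ j * S N 0\<bar> \<le> K" for N by blast
  have "\<bar>R (Suc j) * S N (Suc j) - 2 ^ Suc j * S N 0\<bar> \<le> R j * 3 + 2 * K" for N
  proof -
    have "R (Suc j) * S N (Suc j) - 2 ^ Suc j * S N 0
        = R j * (r j * S N (Suc j) - 2 * S N j) + 2 * (R j * S N j - 2 ^ j * S N 0)"
      by (simp add: R_def algebra_simps)
    moreover have "\<bar>r j * S N (Suc j) - 2 * S N j\<bar> \<le> 3"
      using S_step[of j N] c[of j 0] c[of j "int N"] by auto
    then have "\<bar>R j * (r j * S N (Suc j) - 2 * S N j)\<bar> \<le> R j * 3"
      using R_pos[of j] by (simp add: abs_mult)
    ultimately show ?thesis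
      using K[of N] abs_triangle_ineq[of "R j * (r j * S N (Suc j) - 2 * S N j)"
          "2 * (R j * S N j - 2 ^ j * S N 0)"]
      by (simp only: abs_mult[of 2]) simp
  qed
  then show ?case by blast
qed (auto simp: R_def)

text \<open>Sliding the window by one place trades one digit for another, a change of at most
  4.\<close>

lemma sum_shift_close: "\<bar>(\<Sum>k<N. d j (int k + t)) - S N j\<bar> \<le> 4 * \<bar>t\<bar>"
proof -
  have one: "\<bar>(\<Sum>k<N. d j (int k + (t + 1))) - (\<Sum>k<N. d j (int k + t))\<bar> \<le> 4" for t
  proof -
    have "(\<Sum>k<N. d j (int k + (t + 1))) - (\<Sum>k<N. d j (int k + t)) = d j (int N + t) - d j t"
      by (induction N) (auto simp: algebra_simps)
    then show ?thesis using d[of j "int N + t"] d[of j t] by auto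
  qed
  define f where "f t = (\<Sum>k<N. d j (int k + t))" for t
  have f: "\<bar>f (t + 1) - f t\<bar> \<le> 4" for t
    using one by (simp add: f_def)
  have "\<bar>f t - f 0\<bar> \<le> 4 * \<bar>t\<bar>"
  proof (induction t rule: int_induct[where k = 0])
    case (step1 i)
    then show ?case using f[of i] abs_triangle_ineq[of "f (i + 1) - f i" "f i - f 0"] by simp
  next
    case (step2 i)
    then show ?case using f[of "i - 1"] abs_triangle_ineq[of "f (i - 1) - f i" "f i - f 0"] by simp
  qed simp
  then show ?thesis by (simp add: f_def S_def)
qed

text \<open>Translation changes sums little, so by \<open>S_close\<close> the product
  \<open>(R l - 2 ^ l) * S N 0\<close> is bounded in \<open>N\<close>. Its first factor is odd as
  \<open>l > 0\<close>, and \<open>S N 0\<close> is at least \<open>2 * N\<close>.\<close>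

lemma no_slanted_period:
  assumes "l > 0" "\<And>k. d l k = d 0 (k + t)"
  shows False
proof -
  obtain K where K: "\<bar>R l * S N l - 2 ^ l * S N 0\<bar> \<le> K" for N
    using S_close by blast
  define M where "M = K + R l * (4 * \<bar>t\<bar>)"
  have bound: "2 * int N \<le> M" for N
  proof -
    have "\<bar>S N l - S N 0\<bar> \<le> 4 * \<bar>t\<bar>"
      using sum_shift_close[where N = N and j = 0 and t = t] by (simp add: S_def assms(2))
    then have "\<bar>R l * (S N l - S N 0)\<bar> \<le> R l * (4 * \<bar>t\<bar>)"
      using R_pos[of l] by (simp add: abs_mult)
    moreover have "(R l - 2 ^ l) * S N 0 = (R l * S N l - 2 ^ l * S N 0) - R l * (S N l - S N 0)"
      by (simp add: algebra_simps)
    ultimately have le: "\<bar>(R l - 2 ^ l) * S N 0\<bar> \<le> K + R l * (4 * \<bar>t\<bar>)"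
      using K[of N] by linarith
    have "R l \<noteq> 2 ^ l"
      using odd_R[of l] assms(1) by auto
    then have "1 * \<bar>S N 0\<bar> \<le> \<bar>R l - 2 ^ l\<bar> * \<bar>S N 0\<bar>"
      by (intro mult_right_mono) auto
    then show ?thesis
      using le S_lower[of N 0] by (simp add: abs_mult M_def)
  qed
  show False
    using bound[of "nat M + 1"] by (simp split: if_splits)
qed

end


section \<open>Labellings without periods\<close>

text \<open>The map \<open>u\<close> sends the coset \<open>h\<langle>a\<rangle>\<close> to its parent in the Bass-Serre tree, oriented towards an end,
  and the row of \<open>u h\<close> is the row of \<open>h\<close> multiplied by \<open>2 / ratio h\<close>.\<close>

locale labelling = group G for G (structure) +
  fixes a b :: 'a and u :: "'a \<Rightarrow> 'a" and ratio digit carry :: "'a \<Rightarrow> int"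
  assumes a [simp]: "a \<in> carrier G" and b [simp]: "b \<in> carrier G"
    and gen: "generate G {a, b} = carrier G"
    and u [simp]: "h \<in> carrier G \<Longrightarrow> u h \<in> carrier G"
    and u_a: "h \<in> carrier G \<Longrightarrow> u (h \<otimes> a) = u h \<otimes> a"
    and u_b: "h \<in> carrier G \<Longrightarrow> u h = h \<otimes> b \<or> u (h \<otimes> b) = h"
    and ratio: "h \<in> carrier G \<Longrightarrow> ratio h \<in> {1, 3}"
    and ratio_a: "h \<in> carrier G \<Longrightarrow> ratio (h \<otimes> a) = ratio h"
    and digit: "h \<in> carrier G \<Longrightarrow> digit h \<in> {2..6}"
    and carry: "h \<in> carrier G \<Longrightarrow> carry h \<in> {-2..1}"
    and mult: "h \<in> carrier G \<Longrightarrow> ratio h * digit (u h) + carry h = 2 * digit h + carry (h \<otimes> a)"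
begin

lemma pow_mult: "h \<in> carrier G \<Longrightarrow> h \<otimes> a [^] (k :: int) \<otimes> a [^] l = h \<otimes> a [^] (k + l)"
  by (simp add: int_pow_mult m_assoc)

lemma pow_add1: "h \<in> carrier G \<Longrightarrow> h \<otimes> a [^] (k + 1 :: int) = h \<otimes> a [^] k \<otimes> a"
  by (simp add: int_pow_mult m_assoc)

lemma pow_diff1: "h \<in> carrier G \<Longrightarrow> h \<otimes> a [^] (k - 1 :: int) \<otimes> a = h \<otimes> a [^] k"
  using pow_add1[of h "k - 1"] by simp

lemma u_pow: "h \<in> carrier G \<Longrightarrow> u (h \<otimes> a [^] (k :: int)) = u h \<otimes> a [^] k"
proof (induction k rule: int_induct[where k = 0])
  case (step1 i)
  then show ?case by (simp add: pow_add1 u_a)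
next
  case (step2 i)
  then have "u (h \<otimes> a [^] (i - 1)) \<otimes> a = u h \<otimes> a [^] (i - 1) \<otimes> a"
    by (simp add: pow_diff1 flip: u_a)
  then show ?case using step2 by simp
qed simp

lemma ratio_pow: "h \<in> carrier G \<Longrightarrow> ratio (h \<otimes> a [^] (k :: int)) = ratio h"
proof (induction k rule: int_induct[where k = 0])
  case (step1 i)
  then show ?case by (simp add: pow_add1 ratio_a)
next
  case (step2 i)
  then show ?case using ratio_a[of "h \<otimes> a [^] (i - 1)"] by (simp add: pow_diff1)
qed simp

lemma iter_closed [simp]: "h \<in> carrier G \<Longrightarrow> (u ^^ j) h \<in> carrier G"
  by (induction j) auto

lemma iter_pow: "h \<in> carrier G \<Longrightarrow> (u ^^ j) (h \<otimes> a [^] (k :: int)) = (u ^^ j) h \<otimes> a [^] k"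
  by (induction j) (auto simp: u_pow)

lemma multiplied_rows_iter:
  assumes "h \<in> carrier G"
  shows "multiplied_rows (\<lambda>j. ratio ((u ^^ j) h)) (\<lambda>j k. digit ((u ^^ j) h \<otimes> a [^] k))
           (\<lambda>j k. carry ((u ^^ j) h \<otimes> a [^] k))"
proof
  fix j and k :: int
  let ?h = "(u ^^ j) h"
  show "ratio ?h \<in> {1, 3}" "digit (?h \<otimes> a [^] k) \<in> {2..6}" "carry (?h \<otimes> a [^] k) \<in> {-2..1}"
    using assms by (intro ratio digit carry; simp)+
  show "ratio ?h * digit ((u ^^ Suc j) h \<otimes> a [^] k) + carry (?h \<otimes> a [^] k)
      = 2 * digit (?h \<otimes> a [^] k) + carry (?h \<otimes> a [^] (k + 1))"
    using mult[of "?h \<otimes> a [^] k"] assms by (simp add: ratio_pow u_pow pow_add1)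
qed

section \<open>Merging of ancestor paths\<close>

definition merge :: "'a \<Rightarrow> 'a \<Rightarrow> bool" where
  "merge h h' \<longleftrightarrow> (\<exists>j j' k. (u ^^ j) h = (u ^^ j') h' \<otimes> a [^] (k :: int))"

lemma merge_sym:
  assumes "h \<in> carrier G" "h' \<in> carrier G" "merge h h'"
  shows "merge h' h"
proof -
  obtain j j' and k :: int where "(u ^^ j) h = (u ^^ j') h' \<otimes> a [^] k"
    using assms(3) by (auto simp: merge_def)
  then have "(u ^^ j') h' = (u ^^ j) h \<otimes> a [^] (- k)"
    using assms by (simp add: pow_mult)
  then show ?thesis by (auto simp: merge_def)
qed

text \<open>Applying \<open>u ^^ i\<close> to the first relation and \<open>u ^^ j'\<close> to the
  second makes both speak of the same ancestor of \<open>h'\<close>.\<close>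

lemma merge_trans:
  assumes "h \<in> carrier G" "h' \<in> carrier G" "h'' \<in> carrier G" "merge h h'" "merge h' h''"
  shows "merge h h''"
proof -
  obtain j j' i i' and k l :: int where 1: "(u ^^ j) h = (u ^^ j') h' \<otimes> a [^] k"
    and 2: "(u ^^ i) h' = (u ^^ i') h'' \<otimes> a [^] l"
    using assms(4,5) by (auto simp: merge_def)
  have "(u ^^ (i + j)) h = (u ^^ (i + j')) h' \<otimes> a [^] k"
    using 1 assms by (simp add: funpow_add iter_pow)
  also have "(u ^^ (i + j')) h' = (u ^^ (j' + i')) h'' \<otimes> a [^] l"
    using 2 assms by (simp add: funpow_add iter_pow add.commute[of i])
  also have "(u ^^ (j' + i')) h'' \<otimes> a [^] l \<otimes> a [^] k = (u ^^ (j' + i')) h'' \<otimes> a [^] (l + k)"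
    using assms by (simp add: pow_mult)
  finally show ?thesis by (auto simp: merge_def)
qed

text \<open>Multiplying by \<open>a\<close> stays in the coset; by \<open>u_b\<close>, multiplying
  by \<open>b\<close> leads from a coset to its parent or to a child.\<close>

lemma merge_mult:
  assumes "g \<in> carrier G" "h \<in> carrier G"
  shows "merge h (h \<otimes> g)"
proof -
  have gen_merge: "merge h (h \<otimes> g)" if "g \<in> {a, b}" "h \<in> carrier G" for g h
  proof -
    consider "g = a" | "g = b" "u h = h \<otimes> b" | "g = b" "u (h \<otimes> b) = h"
      using \<open>g \<in> {a, b}\<close> u_b[OF \<open>h \<in> carrier G\<close>] by blast
    then show ?thesis
    proof cases
      case 1
      then have "(u ^^ 0) h = (u ^^ 0) (h \<otimes> g) \<otimes> a [^] (-1 :: int)"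
        using that by (simp add: m_assoc int_pow_neg)
      then show ?thesis unfolding merge_def by blast
    next
      case 2
      then have "(u ^^ 1) h = (u ^^ 0) (h \<otimes> g) \<otimes> a [^] (0 :: int)"
        using that by simp
      then show ?thesis unfolding merge_def by blast
    next
      case 3
      then have "(u ^^ 0) h = (u ^^ 1) (h \<otimes> g) \<otimes> a [^] (0 :: int)"
        using that by simp
      then show ?thesis unfolding merge_def by blast
    qed
  qed
  have "g \<in> generate G {a, b}"
    using assms gen by simp
  then show ?thesis using assms(2)
  proof (induction g arbitrary: h rule: generate.induct)
    case one
    have "(u ^^ 0) h = (u ^^ 0) (h \<otimes> \<one>) \<otimes> a [^] (0 :: int)"
      using one by simp
    then show ?case unfolding merge_def by blast
  next
    case (incl g)
    then show ?case by (rule gen_merge)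
  next
    case (inv g)
    then have g: "g \<in> carrier G" by auto
    have "merge (h \<otimes> inv g) (h \<otimes> inv g \<otimes> g)"
      using gen_merge[OF inv(1), of "h \<otimes> inv g"] inv(2) g by simp
    then have "merge (h \<otimes> inv g) h"
      using inv(2) g by (simp add: m_assoc)
    with inv(2) g show ?case
      by (intro merge_sym[of "h \<otimes> inv g" h]) simp_all
  next
    case (eng g g')
    then have "g \<in> carrier G" "g' \<in> carrier G" using gen by auto
    moreover from this have "merge (h \<otimes> g) (h \<otimes> (g \<otimes> g'))"
      using eng.IH(2)[of "h \<otimes> g"] eng.prems by (simp add: m_assoc)
    ultimately show ?case
      using eng.IH(1)[OF eng.prems] eng.prems merge_trans[of h "h \<otimes> g"] by simp
  qed
qed

theorem no_period:
  assumes g: "g \<in> carrier G"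
    and per_u: "\<And>h. h \<in> carrier G \<Longrightarrow> u (g \<otimes> h) = g \<otimes> u h"
    and per_digit: "\<And>h. h \<in> carrier G \<Longrightarrow> digit (g \<otimes> h) = digit h"
    and per_carry: "\<And>h. h \<in> carrier G \<Longrightarrow> carry (g \<otimes> h) = carry h"
  shows "g = \<one>"
proof (rule ccontr)
  assume "g \<noteq> \<one>"
  have per_iter: "(u ^^ j) (g \<otimes> h) = g \<otimes> (u ^^ j) h" if "h \<in> carrier G" for j h
    using that by (induction j) (auto simp: per_u)
  obtain i j and k :: int where "(u ^^ i) \<one> = (u ^^ j) (\<one> \<otimes> g) \<otimes> a [^] k"
    using merge_mult[OF g one_closed] by (auto simp: merge_def)
  then have eq: "(u ^^ i) \<one> = g \<otimes> (u ^^ j) \<one> \<otimes> a [^] k"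
    using g per_iter[of \<one> j] by simp
  consider "i < j" | "j < i" | "i = j" by linarith
  then show False
  proof cases
    \<comment> \<open>By \<open>eq\<close>, the row of \<open>?h\<close> is up to \<open>g\<close>,
      which preserves digits, a translate of its ancestor \<open>j - i\<close> generations
      up.\<close>
    case 1
    let ?h = "(u ^^ i) \<one>"
    interpret multiplied_rows "\<lambda>j. ratio ((u ^^ j) ?h)" "\<lambda>j k. digit ((u ^^ j) ?h \<otimes> a [^] k)"
      "\<lambda>j k. carry ((u ^^ j) ?h \<otimes> a [^] k)"
      by (rule multiplied_rows_iter) simp
    have j: "(u ^^ (j - i)) ?h = (u ^^ j) \<one>"
      using 1 by (simp flip: funpow_add comp_apply[of "u ^^ (j - i)"])
    show False
    proof (rule no_slanted_period[of "j - i" "- k"])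
      fix m :: int
      have "digit ((u ^^ j) \<one> \<otimes> a [^] m) = digit (g \<otimes> (u ^^ j) \<one> \<otimes> a [^] m)"
        using g per_digit[of "(u ^^ j) \<one> \<otimes> a [^] m"] by (simp add: m_assoc)
      also have "g \<otimes> (u ^^ j) \<one> \<otimes> a [^] m = ?h \<otimes> a [^] (m - k)"
        unfolding eq using g by (simp add: pow_mult)
      finally show "digit ((u ^^ (j - i)) ?h \<otimes> a [^] m) = digit ((u ^^ 0) ?h \<otimes> a [^] (m + - k))"
        by (simp add: j)
    qed (use 1 in simp)
  next
    case 2
    let ?h = "(u ^^ j) \<one>"
    interpret multiplied_rows "\<lambda>j. ratio ((u ^^ j) ?h)" "\<lambda>j k. digit ((u ^^ j) ?h \<otimes> a [^] k)"
      "\<lambda>j k. carry ((u ^^ j) ?h \<otimes> a [^] k)"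
      by (rule multiplied_rows_iter) simp
    have i: "(u ^^ (i - j)) ?h = (u ^^ i) \<one>"
      using 2 by (simp flip: funpow_add comp_apply[of "u ^^ (i - j)"])
    show False
    proof (rule no_slanted_period[of "i - j" k])
      fix m :: int
      have "(u ^^ i) \<one> \<otimes> a [^] m = g \<otimes> (?h \<otimes> a [^] (m + k))"
        unfolding eq using g by (simp add: pow_mult add.commute flip: m_assoc)
      then show "digit ((u ^^ (i - j)) ?h \<otimes> a [^] m) = digit ((u ^^ 0) ?h \<otimes> a [^] (m + k))"
        by (simp add: i per_digit)
    qed (use 2 in simp)
  next
    case 3
    let ?h = "(u ^^ i) \<one>"
    interpret multiplied_rows "\<lambda>j. ratio ((u ^^ j) ?h)" "\<lambda>j k. digit ((u ^^ j) ?h \<otimes> a [^] k)"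
      "\<lambda>j k. carry ((u ^^ j) ?h \<otimes> a [^] k)"
      by (rule multiplied_rows_iter) simp
    \<comment> \<open>\<open>g\<close> slides the row of \<open>?h\<close> along itself; as
      \<open>u\<close> commutes with \<open>g\<close> and with powers of \<open>a\<close>, all
      ancestors inherit the period.\<close>
    have gh: "g \<otimes> ?h = ?h \<otimes> a [^] (- k)"
    proof -
      have "?h \<otimes> a [^] (- k) = g \<otimes> ?h \<otimes> a [^] k \<otimes> a [^] (- k)"
        using eq 3 by simp
      then show ?thesis using g by (simp add: pow_mult)
    qed
    have "k \<noteq> 0"
    proof
      assume "k = 0"
      then have "g \<otimes> ?h = \<one> \<otimes> ?h" using gh by simp
      then show False using g \<open>g \<noteq> \<one>\<close> by simp
    qed
    have per: "carry ((u ^^ m) ?h \<otimes> a [^] (l - k)) = carry ((u ^^ m) ?h \<otimes> a [^] l)" for m l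
    proof -
      have "g \<otimes> (u ^^ m) ?h = (u ^^ m) ?h \<otimes> a [^] (- k)"
        using gh per_iter[of ?h m] by (simp add: iter_pow)
      then have "g \<otimes> ((u ^^ m) ?h \<otimes> a [^] l) = (u ^^ m) ?h \<otimes> a [^] (l - k)"
        using g by (simp add: pow_mult flip: m_assoc)
      then show ?thesis
        using per_carry[of "(u ^^ m) ?h \<otimes> a [^] l"] by simp
    qed
    \<comment> \<open>The two instances of \<open>per\<close> serve negative and positive
      \<open>k\<close>.\<close>
    show False
      by (rule no_horizontal_period[of "nat \<bar>k\<bar>"])
        (use \<open>k \<noteq> 0\<close> per[of _ 0] per[of _ k] in \<open>auto simp: abs_if\<close>)
  qed
qed

end

section \<open>Local rules as subshifts of finite type\<close>

lemma (in group) m_inv_image_carrier: "m_inv G ` carrier G = carrier G"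
proof
  show "carrier G \<subseteq> m_inv G ` carrier G"
  proof
    fix g assume "g \<in> carrier G"
    then show "g \<in> m_inv G ` carrier G"
      by (intro image_eqI[of _ _ "inv g"]) auto
  qed
qed auto

text \<open>The forbidden patterns are those on the window \<open>W\<close> that violate
  \<open>P\<close>, finitely many because \<open>A\<close> and \<open>W\<close> are finite.\<close>

lemma (in group) SFT_local_rule:
  assumes "finite A" "finite W" "W \<subseteq> carrier G"
  shows "SFT G A {x \<in> configurations G A. \<forall>g\<in>carrier G. P (\<lambda>h\<in>W. x (g \<otimes> h))}"
proof -
  define F where "F = Pair W ` {p \<in> W \<rightarrow>\<^sub>E A. \<not> P p}"
  have "finite F"
    unfolding F_def using assms by (intro finite_imageI finite_subset[OF _ finite_PiE[of W "\<lambda>_. A"]]) auto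
  moreover have "F \<subseteq> patterns G A"
    using assms by (auto simp: F_def patterns_def)
  moreover have "(\<forall>g\<in>carrier G. P (\<lambda>h\<in>W. x (g \<otimes> h))) \<longleftrightarrow> (\<forall>p\<in>F. \<not> appears G A p x)"
    if x: "x \<in> configurations G A" for x
  proof -
    have appears: "appears G A (W, p) x \<longleftrightarrow> (\<exists>g\<in>carrier G. p = (\<lambda>h\<in>W. x (g \<otimes> h)))"
      if p: "p \<in> W \<rightarrow>\<^sub>E A" for p
    proof -
      have eq: "(\<forall>h\<in>W. shift G A (inv g) x h = p h) \<longleftrightarrow> p = (\<lambda>h\<in>W. x (g \<otimes> h))"
        if "g \<in> carrier G" for g
      proof -
        have "shift G A (inv g) x h = x (g \<otimes> h)" if "h \<in> W" for h
          using that x assms(3) \<open>g \<in> carrier G\<close> by (auto simp: shift_def)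
        then show ?thesis using p by (auto simp: fun_eq_iff PiE_iff extensional_def)
      qed
      have "appears G A (W, p) x \<longleftrightarrow> (\<exists>g\<in>m_inv G ` carrier G. \<forall>h\<in>W. shift G A g x h = p h)"
        by (simp add: appears_def m_inv_image_carrier)
      also have "\<dots> \<longleftrightarrow> (\<exists>g\<in>carrier G. p = (\<lambda>h\<in>W. x (g \<otimes> h)))"
        by (simp add: eq)
      finally show ?thesis .
    qed
    have "(\<lambda>h\<in>W. x (g \<otimes> h)) \<in> W \<rightarrow>\<^sub>E A" if "g \<in> carrier G" for g
      using that x assms(3) by (auto simp: configurations_def PiE_iff)
    then show ?thesis
      unfolding F_def using appears by blast
  qed
  then have "{x \<in> configurations G A. \<forall>g\<in>carrier G. P (\<lambda>h\<in>W. x (g \<otimes> h))}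
      = {x \<in> configurations G A. \<forall>p\<in>F. \<not> appears G A p x}"
    by (intro Collect_cong conj_cong[OF HOL.refl])
  ultimately show ?thesis
    unfolding SFT_def by (intro exI[of _ F] conjI)
qed

text \<open>A label \<open>(i, e, r, d, c)\<close> at \<open>h\<close> says that the parent edge of \<open>h\<langle>a\<rangle>\<close> is the \<open>b\<close>-edge leaving
  \<open>h a\<^sup>i\<close> if \<open>e\<close> and the one entering \<open>h a\<^sup>i\<close> otherwise; \<open>r\<close>, \<open>d\<close>, \<open>c\<close> are ratio, digit and carry at \<open>h\<close>.\<close>

type_synonym label = "nat \<times> bool \<times> int \<times> int \<times> int"

definition labels :: "nat \<Rightarrow> label set" where
  "labels n = {..<n} \<times> UNIV \<times> {1, 3} \<times> {2..6} \<times> {-2..1}"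

fun ratio_of digit_of carry_of :: "label \<Rightarrow> int" where
  "ratio_of (i, e, r, d, c) = r"
| "digit_of (i, e, r, d, c) = d"
| "carry_of (i, e, r, d, c) = c"

section \<open>The subshift of valid labellings\<close>

locale two_generators = group G for G (structure) +
  fixes a b :: 'a
  assumes a [simp]: "a \<in> carrier G" and b [simp]: "b \<in> carrier G"
    and gen: "generate G {a, b} = carrier G"
begin

text \<open>Walking back as far after crossing the edge aligns positions in a row with those in its
  parent's row, as \<open>u_a\<close> demands.\<close>

fun move :: "label \<Rightarrow> 'a" where
  "move (i, e, _) = a [^] i \<otimes> (if e then b else inv b) \<otimes> inv (a [^] i)"

lemma move_closed [simp]: "move l \<in> carrier G"
  by (cases l) auto

text \<open>The conjuncts are \<open>u_a\<close>, \<open>u_b\<close>, \<open>ratio_a\<close> and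
  \<open>mult\<close> of \<open>labelling\<close> at the point \<open>\<one>\<close>, for the parent
  map given by \<open>move\<close>.\<close>

definition locally_valid :: "('a \<Rightarrow> label) \<Rightarrow> bool" where
  "locally_valid L \<longleftrightarrow>
     a \<otimes> move (L a) = move (L \<one>) \<otimes> a \<and>
     (move (L \<one>) = b \<or> b \<otimes> move (L b) = \<one>) \<and>
     ratio_of (L a) = ratio_of (L \<one>) \<and>
     ratio_of (L \<one>) * digit_of (L (move (L \<one>))) + carry_of (L \<one>) = 2 * digit_of (L \<one>) + carry_of (L a)"

definition valid_configurations :: "nat \<Rightarrow> ('a \<Rightarrow> nat) set" where
  "valid_configurations n = {x \<in> configurations G (to_nat ` labels n).
     \<forall>g\<in>carrier G. locally_valid (\<lambda>h. from_nat (x (g \<otimes> h)))}"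

lemma SFT_valid_configurations: "SFT G (to_nat ` labels n) (valid_configurations n)"
proof -
  let ?A = "to_nat ` labels n"
  \<comment> \<open>The place of the parent depends on the label read at \<open>\<one>\<close>;
    collecting all values of \<open>move\<close> keeps the window finite.\<close>
  define W where "W = {\<one>, a, b} \<union> move ` labels n"
  have fin: "finite (labels n)"
    by (simp add: labels_def)
  have "locally_valid (\<lambda>h. from_nat (x (g \<otimes> h))) \<longleftrightarrow>
      locally_valid (\<lambda>h. from_nat ((\<lambda>h\<in>W. x (g \<otimes> h)) h))"
    if "x \<in> configurations G ?A" "g \<in> carrier G" for x g
  proof -
    have "x g \<in> ?A"
      using that by (auto simp: configurations_def)
    then have "move (from_nat (x g)) \<in> W"
      by (auto simp: W_def)
    then show ?thesis
      using that by (simp add: locally_valid_def W_def)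
  qed
  then have "valid_configurations n = {x \<in> configurations G ?A.
      \<forall>g\<in>carrier G. locally_valid (\<lambda>h. from_nat ((\<lambda>h\<in>W. x (g \<otimes> h)) h))}"
    unfolding valid_configurations_def by blast
  moreover have "SFT G ?A {x \<in> configurations G ?A.
      \<forall>g\<in>carrier G. locally_valid (\<lambda>h. from_nat ((\<lambda>h\<in>W. x (g \<otimes> h)) h))}"
    using fin by (intro SFT_local_rule[where P = "\<lambda>p. locally_valid (\<lambda>h. from_nat (p h))"])
      (auto simp: W_def)
  ultimately show ?thesis by simp
qed

lemma labelling_of_valid:
  assumes "x \<in> valid_configurations n"
  shows "labelling G a b (\<lambda>h. h \<otimes> move (from_nat (x h)))
    (\<lambda>h. ratio_of (from_nat (x h))) (\<lambda>h. digit_of (from_nat (x h))) (\<lambda>h. carry_of (from_nat (x h)))"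
proof
  fix h assume h: "h \<in> carrier G"
  define L where "L g = (from_nat (x g) :: label)" for g
  have "x h \<in> to_nat ` labels n"
    using assms h by (auto simp: valid_configurations_def configurations_def)
  then have "L h \<in> labels n"
    by (auto simp: L_def)
  then show "ratio_of (from_nat (x h)) \<in> {1, 3}" "digit_of (from_nat (x h)) \<in> {2..6}"
    "carry_of (from_nat (x h)) \<in> {-2..1}"
    by (auto simp: labels_def simp flip: L_def)
  have "locally_valid (\<lambda>g. L (h \<otimes> g))"
    using assms h by (simp add: valid_configurations_def L_def)
  then have v: "a \<otimes> move (L (h \<otimes> a)) = move (L h) \<otimes> a"
    "move (L h) = b \<or> b \<otimes> move (L (h \<otimes> b)) = \<one>"
    "ratio_of (L (h \<otimes> a)) = ratio_of (L h)"
    "ratio_of (L h) * digit_of (L (h \<otimes> move (L h))) + carry_of (L h)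
       = 2 * digit_of (L h) + carry_of (L (h \<otimes> a))"
    using h by (auto simp: locally_valid_def)
  show "h \<otimes> a \<otimes> move (from_nat (x (h \<otimes> a))) = h \<otimes> move (from_nat (x h)) \<otimes> a"
    using v(1) h by (simp add: m_assoc flip: L_def)
  show "h \<otimes> move (from_nat (x h)) = h \<otimes> b \<or> h \<otimes> b \<otimes> move (from_nat (x (h \<otimes> b))) = h"
    using v(2) h by (auto simp: m_assoc simp flip: L_def)
  show "ratio_of (from_nat (x (h \<otimes> a))) = ratio_of (from_nat (x h))"
    using v(3) by (simp flip: L_def)
  show "ratio_of (from_nat (x h)) * digit_of (from_nat (x (h \<otimes> move (from_nat (x h)))))
      + carry_of (from_nat (x h)) = 2 * digit_of (from_nat (x h)) + carry_of (from_nat (x (h \<otimes> a)))"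
    using v(4) by (simp flip: L_def)
  show "h \<otimes> move (from_nat (x h)) \<in> carrier G"
    using h by simp
qed (rule a b gen)+

lemma valid_not_weakly_periodic:
  assumes x: "x \<in> valid_configurations n"
  shows "\<not> weakly_periodic G (to_nat ` labels n) x"
proof -
  let ?A = "to_nat ` labels n"
  have conf: "x \<in> configurations G ?A"
    using x by (simp add: valid_configurations_def)
  interpret act: group_action G "configurations G ?A" "shift G ?A"
    by (rule group_action_shift) (rule is_group)
  interpret labelling G a b "\<lambda>h. h \<otimes> move (from_nat (x h))" "\<lambda>h. ratio_of (from_nat (x h))"
    "\<lambda>h. digit_of (from_nat (x h))" "\<lambda>h. carry_of (from_nat (x h))"
    using x by (rule labelling_of_valid)
  have "g = \<one>" if "g \<in> stabilizer G (shift G ?A) x" for g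
  proof -
    from that have g: "g \<in> carrier G" and eq: "shift G ?A g x = x"
      by (auto simp: stabilizer_def)
    have per: "x (g \<otimes> h) = x h" if "h \<in> carrier G" for h
    proof -
      have "x (g \<otimes> h) = shift G ?A g x (g \<otimes> h)"
        by (simp add: eq)
      also have "\<dots> = x h"
        using conf g that by (simp add: shift_def flip: m_assoc)
      finally show ?thesis .
    qed
    show ?thesis
      by (rule no_period) (use g per in \<open>auto simp: m_assoc\<close>)
  qed
  then have "stabilizer G (shift G ?A) x = {\<one>}"
    using act.stabilizer_one_closed[OF conf] by blast
  then show ?thesis
    by (simp add: weakly_periodic_def)
qed

end

section \<open>Existence\<close>

definition BS_relations :: "nat \<Rightarrow> (bs_gen word \<times> bs_gen word) set" where
  "BS_relations n =
     {([(Gen_b, True)] @ replicate n (Gen_a, True) @ [(Gen_b, False)], replicate n (Gen_a, True))}"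

definition word_class :: "nat \<Rightarrow> bs_gen word \<Rightarrow> bs_gen word set" where
  "word_class n u = pres_rel (BS_relations n) `` {u}"

lemma BS_eq: "BS n n = presented_group (BS_relations n)"
  by (simp add: BS_def BS_relations_def)

lemma group_BS: "group (BS n n)"
  by (simp add: BS_eq presented_group_is_group)

lemma carrier_BS: "carrier (BS n n) = range (word_class n)"
  by (simp add: BS_eq presented_group_carrier word_class_def[abs_def])

lemma word_class_mult: "word_class n u \<otimes>\<^bsub>BS n n\<^esub> word_class n v = word_class n (u @ v)"
  by (simp add: BS_eq word_class_def presented_group_mult)

lemma word_class_Nil: "word_class n [] = \<one>\<^bsub>BS n n\<^esub>"
  by (simp add: BS_eq word_class_def presented_group_one)

lemma word_class_eq_iff: "word_class n u = word_class n v \<longleftrightarrow> (u, v) \<in> pres_rel (BS_relations n)"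
  by (simp add: word_class_def eq_equiv_class_iff[OF equiv_pres_rel])

lemma two_generators_BS:
  "two_generators (BS n n) (word_class n [(Gen_a, True)]) (word_class n [(Gen_b, True)])"
proof -
  have "UNIV = {Gen_a, Gen_b}"
    using bs_gen.exhaust by blast
  then have "range f = {f Gen_a, f Gen_b}" for f :: "bs_gen \<Rightarrow> bs_gen word set"
    by (metis image_insert image_empty)
  then have "generate (BS n n) {word_class n [(Gen_a, True)], word_class n [(Gen_b, True)]}
      = carrier (BS n n)"
    using presented_group_generated[of "BS_relations n"] by (simp add: BS_eq word_class_def)
  then show ?thesis
    by (intro two_generators.intro two_generators_axioms.intro group_BS) (simp_all add: carrier_BS)
qed

lemma word_class_inverse_letter: "word_class n [(x, False)] = inv\<^bsub>BS n n\<^esub> word_class n [(x, True)]"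
proof -
  interpret group "BS n n" by (rule group_BS)
  have "word_class n [(x, False)] \<otimes>\<^bsub>BS n n\<^esub> word_class n [(x, True)] = \<one>\<^bsub>BS n n\<^esub>"
    using pres_rel.cancel[of "[]" x False "[]" "BS_relations n"]
    by (simp add: word_class_mult word_class_eq_iff flip: word_class_Nil)
  then show ?thesis
    by (intro inv_equality[symmetric]) (auto simp: carrier_BS)
qed

lemma word_class_replicate:
  "word_class n (replicate k (x, True)) = word_class n [(x, True)] [^]\<^bsub>BS n n\<^esub> k"
proof (induction k)
  case (Suc k)
  then show ?case
    by (simp add: replicate_append_same[symmetric] nat_pow_def flip: word_class_mult)
qed (simp add: word_class_Nil nat_pow_def)

text \<open>A state \<open>(\<sigma>, y, k)\<close> is a vertex of the Bass-Serre tree, given by the edges \<open>\<sigma> 0, \<sigma> 1, \<dots>\<close> of the path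
  to the fixed end, with the number \<open>y\<close> encoded by its row and a position \<open>k\<close> in the row. The
  letter \<open>b\<^sup>\<plusminus>\<^sup>1\<close> moves to the parent if it spells the first edge of the path, and to a child otherwise.\<close>

type_synonym state = "(nat \<Rightarrow> bool \<times> int) \<times> real \<times> int"

section \<open>Action of words on states\<close>

definition ratio_at :: "real \<Rightarrow> int" where "ratio_at y = (if y \<le> 3 then 1 else 3)"

text \<open>This permutes (2, 6]: (2, 3] is doubled onto (4, 6], and (3, 6] is scaled onto (2, 4].
  The inverse is \<open>down\<close>.\<close>

definition up :: "real \<Rightarrow> real" where "up y = (if y \<le> 3 then 2 * y else 2 * y / 3)"

definition down :: "real \<Rightarrow> real" where "down y = (if y \<le> 4 then 3 * y / 2 else y / 2)"

fun letter :: "nat \<Rightarrow> bs_gen \<times> bool \<Rightarrow> state \<Rightarrow> state" where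
  "letter n (Gen_a, e) (\<sigma>, y, k) = (\<sigma>, y, if e then k + 1 else k - 1)"
| "letter n (Gen_b, e) (\<sigma>, y, k) =
     (if \<sigma> 0 = (e, k mod int n) then (\<sigma> \<circ> Suc, up y, k)
      else (case_nat (\<not> e, k mod int n) \<sigma>, down y, k))"

text \<open>The last conjunct excludes backtracking; it makes the moves along \<open>b\<close> and \<open>b\<^sup>-\<^sup>1\<close> mutually inverse.\<close>

definition states :: "nat \<Rightarrow> state set" where
  "states n = {(\<sigma>, y, k). 2 < y \<and> y \<le> 6 \<and>
     (\<forall>i. snd (\<sigma> i) mod int n = snd (\<sigma> i) \<and> \<sigma> (Suc i) \<noteq> (\<not> fst (\<sigma> i), snd (\<sigma> i)))}"

text \<open>Descending to a child puts \<open>(\<not> e, k mod int n)\<close> in front of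
  \<open>\<sigma>\<close>; this is no backtracking because that branch has
  \<open>\<sigma> 0 \<noteq> (e, k mod int n)\<close>.\<close>

lemma letter_states: "s \<in> states n \<Longrightarrow> letter n l s \<in> states n"
proof (cases "(n, l, s)" rule: letter.cases)
  case (2 m e \<sigma> y k)
  assume "s \<in> states n"
  with 2 show ?thesis
    by (auto simp: states_def up_def down_def split: nat.split)
qed (auto simp: states_def)

lemma letter_cancel: "s \<in> states n \<Longrightarrow> letter n (x, \<not> e) (letter n (x, e) s) = s"
proof (cases "(n, (x, e), s)" rule: letter.cases)
  case (2 m e \<sigma> y k)
  assume s: "s \<in> states n"
  have *: "case_nat (\<sigma> 0) (\<sigma> \<circ> Suc) = \<sigma>" "case_nat z \<sigma> \<circ> Suc = \<sigma>" for z
    by (auto simp: fun_eq_iff split: nat.split)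
  \<comment> \<open>After a move to the parent, this inequality sends the inverse letter into the
    child branch, which restores \<open>\<sigma> 0\<close>.\<close>
  have "\<sigma> (Suc 0) \<noteq> (\<not> fst (\<sigma> 0), snd (\<sigma> 0))" "2 < y" "y \<le> 6"
    using s 2 by (auto simp: states_def)
  then show ?thesis
    using 2 * by (auto simp: up_def down_def)
qed auto

abbreviation run :: "nat \<Rightarrow> bs_gen word \<Rightarrow> state \<Rightarrow> state" where
  "run n \<equiv> fold (letter n)"

lemma run_states: "s \<in> states n \<Longrightarrow> run n u s \<in> states n"
  by (induction u arbitrary: s) (auto simp: letter_states)

lemma letter_a_funpow: "(letter n (Gen_a, True) ^^ i) (\<sigma>, y, k) = (\<sigma>, y, k + int i)"
  by (induction i arbitrary: k) auto

text \<open>The letters over \<open>Gen_b\<close> see the position only modulo \<open>n\<close>, so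
  after \<open>n\<close> steps along the row the last letter still undoes the first.\<close>

lemma run_relation:
  assumes "s \<in> states n"
  shows "run n ([(Gen_b, True)] @ replicate n (Gen_a, True) @ [(Gen_b, False)]) s
    = run n (replicate n (Gen_a, True)) s"
proof -
  obtain \<sigma> y k where s: "s = (\<sigma>, y, k)" by (cases s)
  let ?s = "letter n (Gen_b, True) s"
  obtain \<sigma>' y' where s': "?s = (\<sigma>', y', k)"
    by (cases "\<sigma> 0 = (True, k mod int n)") (auto simp: s)
  have "(\<sigma>, y, k) = letter n (Gen_b, False) (\<sigma>', y', k)"
    using letter_cancel[OF assms, of Gen_b True] unfolding s' by (simp only: s not_True_eq_False)
  then have "letter n (Gen_b, False) (\<sigma>', y', k + int n) = (\<sigma>, y, k + int n)"
    by (auto split: if_splits)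
  then show ?thesis
    by (simp add: s' letter_a_funpow) (simp add: s letter_a_funpow)
qed

text \<open>Hence the state reached from \<open>start\<close> depends on the group element only, not
  on the word spelling it.\<close>

lemma run_pres_rel:
  "(u, v) \<in> pres_rel (BS_relations n) \<Longrightarrow> s \<in> states n \<Longrightarrow> run n u s = run n v s"
proof (induction arbitrary: s rule: pres_rel.induct)
  case (cancel u x e v)
  then show ?case by (simp add: letter_cancel run_states)
next
  case (relation l r u v)
  then show ?case
    using run_relation[OF run_states[OF relation(2), of u]] by (simp add: BS_relations_def)
qed auto

definition start :: state where
  "start = (\<lambda>_. (True, 0), 3, 0)"

lemma start_states: "start \<in> states n"
  by (simp add: start_def states_def)

definition state_of :: "nat \<Rightarrow> bs_gen word set \<Rightarrow> state" where
  "state_of n g = run n (SOME u. g = word_class n u) start"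

lemma state_of_word_class: "state_of n (word_class n u) = run n u start"
proof -
  have "word_class n u = word_class n (SOME v. word_class n u = word_class n v)"
    by (rule someI) simp
  then show ?thesis
    unfolding state_of_def using run_pres_rel start_states by (metis word_class_eq_iff)
qed

lemma state_of_mult:
  assumes "g \<in> carrier (BS n n)"
  shows "state_of n (g \<otimes>\<^bsub>BS n n\<^esub> word_class n u) = run n u (state_of n g)"
proof -
  obtain v where "g = word_class n v"
    using assms by (auto simp: carrier_BS)
  then show ?thesis by (simp add: word_class_mult state_of_word_class)
qed

lemma state_of_states: "g \<in> carrier (BS n n) \<Longrightarrow> state_of n g \<in> states n"
  by (auto simp: carrier_BS state_of_word_class run_states start_states)

section \<open>Beatty labels\<close>

definition beatty :: "real \<Rightarrow> int \<Rightarrow> int" where "beatty y k = \<lfloor>of_int k * y\<rfloor>"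

text \<open>The carry is the gap between the parent's Beatty sequence scaled by
  \<open>ratio_at y\<close> and the row's own scaled by 2, so that the multiplication rule
  telescopes.\<close>

fun label_at :: "nat \<Rightarrow> state \<Rightarrow> label" where
  "label_at n (\<sigma>, y, k) =
     (nat ((snd (\<sigma> 0) - k) mod int n), fst (\<sigma> 0), ratio_at y, beatty y (k + 1) - beatty y k,
      ratio_at y * beatty (up y) k - 2 * beatty y k)"

text \<open>Since \<open>ratio_at y * up y = 2 * y\<close>, the carry is twice the fractional part
  of \<open>k * y\<close> minus \<open>ratio_at y\<close> times that of \<open>k * up y\<close>, an
  integer strictly between \<open>- ratio_at y\<close> and 2.\<close>

lemma label_at_labels:
  assumes "s \<in> states n" "n > 0"
  shows "label_at n s \<in> labels n"
proof -
  obtain \<sigma> y k where s: "s = (\<sigma>, y, k)" by (cases s)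
  have y: "2 < y" "y \<le> 6" using assms by (auto simp: s states_def)
  have "beatty y (k + 1) - beatty y k \<in> {2..6}"
  proof -
    have "real_of_int (k + 1) * y = of_int k * y + y"
      by (simp add: algebra_simps)
    then show ?thesis
      using y unfolding beatty_def atLeastAtMost_iff by linarith
  qed
  moreover have "ratio_at y * beatty (up y) k - 2 * beatty y k \<in> {-2..1}"
  proof (cases "y \<le> 3")
    case True
    then have "real_of_int k * up y = 2 * (of_int k * y)"
      by (simp add: up_def)
    then show ?thesis
      using True unfolding beatty_def ratio_at_def atLeastAtMost_iff by (simp, linarith)
  next
    case False
    then have "3 * (real_of_int k * up y) = 2 * (of_int k * y)"
      by (simp add: up_def)
    then show ?thesis
      using False unfolding beatty_def ratio_at_def atLeastAtMost_iff by (simp, linarith)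
  qed
  moreover have "nat ((snd (\<sigma> 0) - k) mod int n) < n"
    using assms(2) by (simp add: nat_less_iff)
  ultimately show ?thesis
    by (simp add: s labels_def ratio_at_def)
qed


text \<open>The relation \<open>b a\<^sup>n b\<^sup>-\<^sup>1 = a\<^sup>n\<close> is needed when the index wraps around.\<close>

lemma (in two_generators) move_shift:
  assumes comm: "a [^] n \<otimes> b = b \<otimes> a [^] n" and "n > 0"
  shows "a \<otimes> move (nat ((t - (k + 1)) mod int n), e, z) = move (nat ((t - k) mod int n), e, z') \<otimes> a"
proof -
  define c where "c = (if e then b else inv b)"
  have c: "c \<in> carrier G" by (simp add: c_def)
  have "a [^] n \<otimes> inv b = inv b \<otimes> a [^] n"
  proof -
    have "inv b \<otimes> (a [^] n \<otimes> b) \<otimes> inv b = a [^] n \<otimes> inv b"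
      unfolding comm by (simp flip: m_assoc)
    then show ?thesis by (simp add: m_assoc)
  qed
  then have comm_c: "a [^] n \<otimes> c = c \<otimes> a [^] n"
    using comm by (simp add: c_def)
  define j where "j = nat ((t - (k + 1)) mod int n)"
  define i where "i = nat ((t - k) mod int n)"
  have j: "int j = (t - (k + 1)) mod int n" "j < n"
    using \<open>n > 0\<close> by (simp_all add: j_def nat_less_iff)
  have "(t - k) mod int n = (int j + 1) mod int n"
    unfolding j(1) by (simp add: mod_simps)
  then have "(t - k) mod int n = int (Suc j mod n)"
    by (simp add: zmod_int add.commute)
  then have ij: "i = (if Suc j = n then 0 else Suc j)"
    using j(2) by (simp add: i_def)
  have "a [^] Suc j \<otimes> c \<otimes> inv (a [^] Suc j) = a [^] i \<otimes> c \<otimes> inv (a [^] i)"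
  proof (cases "Suc j = n")
    case True
    then show ?thesis
      unfolding True ij using c by (simp add: comm_c m_assoc)
  qed (simp add: ij)
  moreover have "a \<otimes> (a [^] j \<otimes> c \<otimes> inv (a [^] j)) = a [^] Suc j \<otimes> c \<otimes> inv (a [^] Suc j) \<otimes> a"
  proof -
    have "inv (a [^] Suc j) \<otimes> a = inv (a [^] j)"
      unfolding nat_pow_Suc2[OF a] by (simp add: inv_mult_group m_assoc)
    then have "a [^] Suc j \<otimes> c \<otimes> inv (a [^] Suc j) \<otimes> a = a [^] Suc j \<otimes> c \<otimes> inv (a [^] j)"
      using c by (simp add: m_assoc del: nat_pow_Suc)
    moreover have "a \<otimes> (a [^] j \<otimes> c \<otimes> inv (a [^] j)) = a [^] Suc j \<otimes> c \<otimes> inv (a [^] j)"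
      unfolding nat_pow_Suc2[OF a] using c by (simp add: m_assoc)
    ultimately show ?thesis by (simp only:)
  qed
  ultimately show ?thesis
    by (simp add: c_def flip: i_def j_def)
qed

lemma valid_configurations_nonempty:
  fixes G :: "bs_gen word set monoid" (structure)
  assumes G: "G = BS n n" and "n > 0"
    and ab: "a = word_class n [(Gen_a, True)]" "b = word_class n [(Gen_b, True)]"
  shows "two_generators.valid_configurations G a b n \<noteq> {}"
proof -
  interpret two_generators G a b
    using two_generators_BS by (simp add: G ab)
  have comm: "a [^] n \<otimes> b = b \<otimes> a [^] n"
  proof -
    have "word_class n ([(Gen_b, True)] @ replicate n (Gen_a, True) @ [(Gen_b, False)])
        = word_class n (replicate n (Gen_a, True))"
      using pres_rel.relation[of _ _ "BS_relations n" "[]" "[]"]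
      by (simp add: word_class_eq_iff BS_relations_def)
    then have "b \<otimes> (a [^] n \<otimes> inv b) = a [^] n"
      by (simp only: ab G word_class_replicate word_class_inverse_letter flip: word_class_mult)
    then have "b \<otimes> (a [^] n \<otimes> inv b) \<otimes> b = a [^] n \<otimes> b"
      by simp
    then show ?thesis by (simp add: m_assoc)
  qed
  define L where "L g = label_at n (state_of n g)" for g
  have st: "state_of n (g \<otimes> a) = letter n (Gen_a, True) (state_of n g)"
    "state_of n (g \<otimes> b) = letter n (Gen_b, True) (state_of n g)"
    "state_of n (g \<otimes> inv b) = letter n (Gen_b, False) (state_of n g)"
    if "g \<in> carrier G" for g
    using that state_of_mult[of g n]
    by (simp_all add: ab G flip: word_class_inverse_letter)
  have st_pow: "state_of n (g \<otimes> a [^] i) = (\<sigma>, y, k + int i)"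
    if "g \<in> carrier G" "state_of n g = (\<sigma>, y, k)" for g i \<sigma> y k
    using that state_of_mult[of g n "replicate i (Gen_a, True)"]
    by (simp add: ab G word_class_replicate letter_a_funpow)
  have st_inv_pow: "state_of n (g \<otimes> inv (a [^] i)) = (\<sigma>, y, k - int i)"
    if g: "g \<in> carrier G" and s: "state_of n g = (\<sigma>, y, k)" for g i \<sigma> y k
  proof -
    obtain \<sigma>' y' k' where s': "state_of n (g \<otimes> inv (a [^] i)) = (\<sigma>', y', k')"
      by (cases "state_of n (g \<otimes> inv (a [^] i))")
    have "state_of n (g \<otimes> inv (a [^] i) \<otimes> a [^] i) = (\<sigma>', y', k' + int i)"
      using g by (intro st_pow s') simp
    then show ?thesis
      using g s s' by (simp add: m_assoc)
  qed
  have valid: "locally_valid (\<lambda>h. L (g \<otimes> h))" if g: "g \<in> carrier G" for g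
  proof -
    obtain \<sigma> y k where s: "state_of n g = (\<sigma>, y, k)" by (cases "state_of n g")
    define e where "e = fst (\<sigma> 0)"
    define t where "t = snd (\<sigma> 0)"
    define i where "i = nat ((t - k) mod int n)"
    have L: "L g = (i, e, ratio_at y, beatty y (k + 1) - beatty y k,
        ratio_at y * beatty (up y) k - 2 * beatty y k)"
      by (simp add: L_def s i_def e_def t_def)
    have La: "L (g \<otimes> a) = (nat ((t - (k + 1)) mod int n), e, ratio_at y,
        beatty y (k + 1 + 1) - beatty y (k + 1), ratio_at y * beatty (up y) (k + 1) - 2 * beatty y (k + 1))"
      using g by (simp add: L_def s st e_def t_def)
    have "a \<otimes> move (L (g \<otimes> a)) = move (L g) \<otimes> a"
      unfolding L La i_def by (rule move_shift[OF comm \<open>n > 0\<close>])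
    moreover have "move (L g) = b \<or> b \<otimes> move (L (g \<otimes> b)) = \<one>"
    \<comment> \<open>If \<open>b\<close> at \<open>g\<close> is the parent edge, the index is 0.
      Otherwise \<open>g \<otimes> b\<close> is a child whose recorded first edge leads back by
      \<open>inv b\<close>, again with index 0.\<close>
    proof (cases "\<sigma> 0 = (True, k mod int n)")
      case True
      then show ?thesis by (simp add: L i_def e_def t_def mod_simps)
    next
      case False
      then have "state_of n (g \<otimes> b) = (case_nat (False, k mod int n) \<sigma>, down y, k)"
        using g by (simp add: s st)
      then show ?thesis by (simp add: L_def mod_simps)
    qed
    moreover have "L (g \<otimes> move (L g)) = label_at n (\<sigma> \<circ> Suc, up y, k)"
    proof -
      have "(\<sigma>, y, k) \<in> states n"
        using state_of_states[of g n] g s by (simp add: G)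
      \<comment> \<open>In a state \<open>snd (\<sigma> 0)\<close> is reduced modulo
        \<open>n\<close>, so \<open>i\<close> steps along \<open>a\<close> reach the parent
        edge.\<close>
      then have "(k + int i) mod int n = t"
        using \<open>n > 0\<close> by (simp add: i_def t_def states_def mod_simps)
      then have "\<sigma> 0 = (e, (k + int i) mod int n)"
        by (simp add: e_def t_def)
      then have "state_of n (g \<otimes> a [^] i \<otimes> (if e then b else inv b)) = (\<sigma> \<circ> Suc, up y, k + int i)"
        using g st_pow[OF g s, of i] by (simp add: st)
      then have "state_of n (g \<otimes> a [^] i \<otimes> (if e then b else inv b) \<otimes> inv (a [^] i)) = (\<sigma> \<circ> Suc, up y, k)"
        using g by (subst st_inv_pow) auto
      moreover have "g \<otimes> a [^] i \<otimes> (if e then b else inv b) \<otimes> inv (a [^] i) = g \<otimes> move (L g)"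
        using g by (simp add: L m_assoc)
      ultimately show ?thesis by (simp add: L_def)
    qed
    \<comment> \<open>Both sides of the multiplication rule reduce to
      \<open>ratio_at y * beatty (up y) (k + 1) - 2 * beatty y k\<close>.\<close>
    ultimately show ?thesis
      using g by (simp add: locally_valid_def L La algebra_simps)
  qed
  define x where "x = (\<lambda>g\<in>carrier G. to_nat (L g))"
  have "L g \<in> labels n" if "g \<in> carrier G" for g
    using that \<open>n > 0\<close> state_of_states[of g n] unfolding L_def by (intro label_at_labels) (simp_all add: G)
  then have "x \<in> configurations G (to_nat ` labels n)"
    by (auto simp: x_def configurations_def)
  moreover have "locally_valid (\<lambda>h. from_nat (x (g \<otimes> h)))" if "g \<in> carrier G" for g
    using valid[OF that] that by (simp add: locally_valid_def x_def)
  ultimately show ?thesis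
    by (auto simp: valid_configurations_def)
qed

theorem theorem4p4:
  fixes n :: nat
  assumes "n \<ge> 2"
  shows "\<exists>(A :: nat set) X. finite A \<and> SFT (BS n n) A X \<and> strongly_aperiodic (BS n n) A X"
proof -
  let ?a = "word_class n [(Gen_a, True)]" and ?b = "word_class n [(Gen_b, True)]"
  interpret two_generators "BS n n" ?a ?b
    by (rule two_generators_BS)
  have "finite (to_nat ` labels n)"
    by (simp add: labels_def)
  moreover have "SFT (BS n n) (to_nat ` labels n) (valid_configurations n)"
    by (rule SFT_valid_configurations)
  moreover have "strongly_aperiodic (BS n n) (to_nat ` labels n) (valid_configurations n)"
    using valid_configurations_nonempty[of "BS n n" n ?a ?b] assms valid_not_weakly_periodic
    by (simp add: strongly_aperiodic_def)
  ultimately show ?thesis by blast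
qed

end
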